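(* Let $X$ be an infinite dimensional Banach space. Then there exist a nonempty compact convex set $K\subset X$ and a fixed-point-free affine mapping $T\colon K\to K$ which is of asymptotically Hölder nonexpansive type and such that none of its positive iterates $T^n$ ($n\ge1$) is continuous.
   Context: Let $K$ be a nonempty subset of a Banach space $X$. A mapping $T\colon K\to K$ is of asymptotically Hölder nonexpansive type if there exists a sequence $(\alpha_n)\subset(0,1]$ with $\alpha_n\to1$ such that, for every $x\in K$, $\limsup_{n\to\infty}\sup_{y\in K}\left(\|T^n x-T^n y\|-\|x-y\|^{\alpha_n}\right)\le 0$, where $T^n$ is the $n$-th iterate of $T$. A mapping $T$ on a convex set $K$ is affine if $T(\lambda x+(1-\lambda)y)=\lambda T(x)+(1-\lambda)T(y)$ for all $x,y\in K$ and $\lambda\in[0,1]$. Compactness and continuity are with respect to the norm topology. *)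

theory Defs
  imports "HOL-Analysis.Analysis"
begin

definition infinite_dimensional :: "'a::real_vector itself \<Rightarrow> bool" where
  "infinite_dimensional _ \<longleftrightarrow> \<not> (\<exists>B :: 'a set. finite B \<and> span B = UNIV)"

definition affine_map_on :: "'a::real_vector set \<Rightarrow> ('a \<Rightarrow> 'b::real_vector) \<Rightarrow> bool" where
  "affine_map_on K T \<longleftrightarrow>
     (\<forall>x\<in>K. \<forall>y\<in>K. \<forall>t::real. 0 \<le> t \<and> t \<le> 1 \<longrightarrow>
        T (t *\<^sub>R x + (1 - t) *\<^sub>R y) = t *\<^sub>R T x + (1 - t) *\<^sub>R T y)"

(* The supremum over K need not be finite, so it and the limsup are taken in the
   extended reals. Since \<alpha> n > 0, the convention 0 powr a = 0 agrees with the usual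
   value of ||x - y|| to the power \<alpha> n at y = x. *)
definition asymptotically_Hoelder_nonexpansive_type ::
    "'a::real_normed_vector set \<Rightarrow> ('a \<Rightarrow> 'a) \<Rightarrow> bool" where
  "asymptotically_Hoelder_nonexpansive_type K T \<longleftrightarrow>
     (\<exists>\<alpha> :: nat \<Rightarrow> real.
        (\<forall>n. 0 < \<alpha> n \<and> \<alpha> n \<le> 1) \<and> \<alpha> \<longlonglongrightarrow> 1 \<and>
        (\<forall>x\<in>K. limsup (\<lambda>n. SUP y\<in>K.
            ereal (norm ((T ^^ n) x - (T ^^ n) y) - norm (x - y) powr \<alpha> n)) \<le> 0))"

end

theory Submission
  imports Defs
begin

text \<open>
  Suppose that \<open>e\<^sub>0, e\<^sub>1, \<dots>\<close> is a sequence in the space with \<open>norm (e n) \<le> (1/2) ^ n\<close> such that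
  an absolutely summable coefficient sequence \<open>t\<close> is determined by the vector \<open>\<Sum>n. t n *\<^sub>R e n\<close>. Let
  \<open>K\<close> be the set of all these vectors with \<open>t \<ge> 0\<close> and \<open>\<Sum>n. t n \<le> 1\<close>, an infinite-dimensional
  simplex with vertices \<open>0, e\<^sub>0, e\<^sub>1, \<dots>\<close>, where \<open>0\<close> carries the weight \<open>1 - (\<Sum>n. t n)\<close>. Let \<open>T\<close> be
  the affine map that sends the vertex \<open>0\<close> to \<open>e\<^sub>0\<close> and each \<open>e\<^sub>n\<close> to \<open>e\<^sub>n\<^sub>+\<^sub>1\<close>; on coefficients it is
  the shift \<open>t \<mapsto> (1 - (\<Sum>n. t n), t 0, t 1, \<dots>)\<close>.

  \<^item> \<open>K\<close> is compact, being the continuous image of a closed subset of the cube \<open>[0, 1]\<^sup>\<nat>\<close>.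
  \<^item> A fixed point would have constant, hence (by summability) zero coefficients, but the shift of
    the zero sequence is not zero.
  \<^item> \<open>T\<^sup>n\<^sup>+\<^sup>1\<close> maps \<open>K\<close> into the combinations of \<open>e\<^sub>n, e\<^sub>n\<^sub>+\<^sub>1, \<dots>\<close>, so into the ball of radius
    \<open>(1/2) ^ n\<close>. The distances \<open>norm (T\<^sup>n x - T\<^sup>n y)\<close> thus tend to \<open>0\<close> uniformly, and the Hoelder
    condition holds with all exponents equal to \<open>1\<close>.
  \<^item> \<open>e\<^sub>m\<close> tends to \<open>0\<close> and so does \<open>T\<^sup>n e\<^sub>m = e\<^sub>m\<^sub>+\<^sub>n\<close>, whereas \<open>T\<^sup>n 0 = e\<^sub>n\<^sub>-\<^sub>1\<close> is not \<open>0\<close>. So no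
    \<open>T\<^sup>n\<close> with \<open>n \<ge> 1\<close> is continuous at \<open>0\<close>.

  Linear independence of the \<open>e\<^sub>n\<close> does not suffice for the uniqueness of coefficients. It is ensured
  by continuous functionals \<open>f\<^sub>n\<close> with \<open>f\<^sub>n (e\<^sub>n) \<noteq> 0\<close> and \<open>f\<^sub>n (e\<^sub>m) = 0\<close> for \<open>m > n\<close>: applied to a
  vanishing series they kill its coefficients one after the other. To find them, choose \<open>e\<^sub>n\<close> in the
  common kernel of the earlier functionals, which is still infinite-dimensional, and then \<open>f\<^sub>n\<close> by the
  Hahn-Banach theorem, which is obtained here from minimal sublinear functionals.
\<close>

section \<open>Continuous functionals that do not vanish at a given point\<close>

text \<open>
  Homogeneity is required as an inequality only; the reverse inequality follows, see
  \<open>sublinear_scale\<close>.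
\<close>

definition sublinear :: "('a::real_vector \<Rightarrow> real) \<Rightarrow> bool" where
  "sublinear p \<longleftrightarrow> (\<forall>x y. p (x + y) \<le> p x + p y) \<and> (\<forall>c\<ge>0. \<forall>x. p (c *\<^sub>R x) \<le> c * p x)"

lemma sublinear_add: "sublinear p \<Longrightarrow> p (x + y) \<le> p x + p y"
  by (simp add: sublinear_def)

lemma sublinear_zero:
  assumes "sublinear p" shows "p 0 = 0"
proof (rule antisym)
  have "p (0 *\<^sub>R 0) \<le> 0 * p 0"
    using assms unfolding sublinear_def by blast
  then show "p 0 \<le> 0" by simp
  show "0 \<le> p 0" using sublinear_add[OF assms, of 0 0] by simp
qed

lemma sublinear_scale:
  assumes "sublinear p" "c \<ge> 0" shows "p (c *\<^sub>R x) = c * p x"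
proof (cases "c = 0")
  case False
  then have c: "c > 0" using assms by simp
  have "p ((1 / c) *\<^sub>R (c *\<^sub>R x)) \<le> (1 / c) * p (c *\<^sub>R x)"
    using assms c unfolding sublinear_def by (meson less_eq_real_def divide_pos_pos zero_less_one)
  then have "c * p x \<le> p (c *\<^sub>R x)"
    using c by (simp add: field_simps)
  moreover have "p (c *\<^sub>R x) \<le> c * p x"
    using assms unfolding sublinear_def by blast
  ultimately show ?thesis by simp
qed (simp add: sublinear_zero assms)

lemma sublinear_lower: "sublinear p \<Longrightarrow> - p (- x) \<le> p x"
  using sublinear_add[of p x "- x"] sublinear_zero[of p] by simp

text \<open>
  A sublinear functional that is not odd at \<open>y\<close> can be lowered strictly: the infimum of
  \<open>p (x + t *\<^sub>R y) - t * p y\<close> over \<open>t \<ge> 0\<close> is sublinear in \<open>x\<close>, lies below \<open>p\<close>, and is at most \<open>- p y\<close>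
  at \<open>x = - y\<close>.
\<close>

lemma sublinear_lowering:
  fixes p :: "'a::real_vector \<Rightarrow> real"
  assumes p: "sublinear p"
  obtains q where "sublinear q" "\<And>x. q x \<le> p x" "q (- y) \<le> - p y"
proof -
  define q where "q x = (INF t\<in>{0..}. p (x + t *\<^sub>R y) - t * p y)" for x
  have lower: "- p (- x) \<le> p (x + t *\<^sub>R y) - t * p y" if "t \<ge> 0" for x t
    using sublinear_add[OF p, of "x + t *\<^sub>R y" "- x"] sublinear_scale[OF p that, of y]
    by simp
  have bdd: "bdd_below ((\<lambda>t. p (x + t *\<^sub>R y) - t * p y) ` {0..})" for x
    using lower by (intro bdd_belowI2[of _ "- p (- x)"]) auto
  have le: "q x \<le> p (x + t *\<^sub>R y) - t * p y" if "t \<ge> 0" for x t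
    unfolding q_def using that by (intro cINF_lower bdd) auto
  have ge: "a \<le> q x" if "\<And>t. t \<ge> 0 \<Longrightarrow> a \<le> p (x + t *\<^sub>R y) - t * p y" for a x
    unfolding q_def using that by (intro cINF_greatest) auto
  have "q (x + x') \<le> q x + q x'" for x x'
  proof -
    have "q (x + x') - (p (x' + s *\<^sub>R y) - s * p y) \<le> p (x + t *\<^sub>R y) - t * p y"
      if "s \<ge> 0" "t \<ge> 0" for s t
    proof -
      have "q (x + x') \<le> p ((x + x') + (t + s) *\<^sub>R y) - (t + s) * p y"
        using that by (intro le) auto
      also have "(x + x') + (t + s) *\<^sub>R y = (x + t *\<^sub>R y) + (x' + s *\<^sub>R y)"
        by (simp add: algebra_simps)
      also have "p \<dots> \<le> p (x + t *\<^sub>R y) + p (x' + s *\<^sub>R y)"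
        by (rule sublinear_add[OF p])
      finally show ?thesis by (simp add: algebra_simps)
    qed
    then have "q (x + x') - (p (x' + s *\<^sub>R y) - s * p y) \<le> q x" if "s \<ge> 0" for s
      using that by (intro ge) auto
    then have "q (x + x') - q x \<le> q x'"
      by (intro ge) (simp add: algebra_simps)
    then show ?thesis by simp
  qed
  moreover have "q (c *\<^sub>R x) \<le> c * q x" if c: "c \<ge> 0" for c x
  proof (cases "c = 0")
    case True
    then show ?thesis using le[of 0 0] sublinear_zero[OF p] by simp
  next
    case False
    then have c: "c > 0" using that by simp
    have "q (c *\<^sub>R x) / c \<le> p (x + t *\<^sub>R y) - t * p y" if "t \<ge> 0" for t
    proof -
      have "q (c *\<^sub>R x) \<le> p (c *\<^sub>R x + (c * t) *\<^sub>R y) - (c * t) * p y"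
        using that c by (intro le) auto
      also have "c *\<^sub>R x + (c * t) *\<^sub>R y = c *\<^sub>R (x + t *\<^sub>R y)"
        by (simp add: algebra_simps)
      also have "p \<dots> = c * p (x + t *\<^sub>R y)"
        using sublinear_scale[OF p] c by simp
      finally show ?thesis using c by (simp add: field_simps)
    qed
    then have "q (c *\<^sub>R x) / c \<le> q x" by (rule ge)
    then show ?thesis using c by (simp add: field_simps)
  qed
  ultimately have "sublinear q"
    by (simp add: sublinear_def)
  moreover have "q x \<le> p x" for x
    using le[of 0 x] by simp
  moreover have "q (- y) \<le> - p y"
    using le[of 1 "- y"] sublinear_zero[OF p] by simp
  ultimately show thesis by (rule that)
qed

lemma linear_minimal_sublinear:
  assumes p: "sublinear p"
    and min: "\<And>q. sublinear q \<Longrightarrow> (\<And>x. q x \<le> p x) \<Longrightarrow> q = p"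
  shows "linear p"
proof -
  have neg: "p (- y) = - p y" for y
  proof -
    obtain q where "sublinear q" "\<And>x. q x \<le> p x" "q (- y) \<le> - p y"
      using sublinear_lowering[OF p] by blast
    then have "p (- y) \<le> - p y" using min by blast
    then show ?thesis using sublinear_lower[OF p, of y] by simp
  qed
  show ?thesis
  proof (rule linearI)
    fix x y :: 'a and c :: real
    show "p (x + y) = p x + p y"
      using sublinear_add[OF p, of x y] sublinear_add[OF p, of "x + y" "- y"] neg[of y] by simp
    show "p (c *\<^sub>R x) = c *\<^sub>R p x"
      using sublinear_scale[OF p, of c x] sublinear_scale[OF p, of "- c" x] neg[of "c *\<^sub>R x"]
      by (cases "c \<ge> 0") auto
  qed
qed

text \<open>
  The Hahn-Banach theorem in its sublinear form, by Zorn's lemma: the pointwise infimum of a chain of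
  sublinear functionals below \<open>p\<close> is sublinear, and minimal sublinear functionals are linear.
\<close>

lemma linear_below_sublinear:
  fixes p :: "'a::real_vector \<Rightarrow> real"
  assumes p: "sublinear p"
  obtains f where "linear f" "\<And>x. f x \<le> p x"
proof -
  define A where "A = {q. sublinear q \<and> q \<le> p}"
  \<comment> \<open>The order is reversed, since Zorn's lemma provides maximal elements.\<close>
  define ge where "ge = (\<lambda>q r :: 'a \<Rightarrow> real. r \<le> q)"
  have "\<exists>m\<in>A. \<forall>q\<in>A. ge m q \<longrightarrow> q = m"
  proof (rule predicate_Zorn)
    show "partial_order_on A (relation_of ge A)"
      by (rule partial_order_on_relation_ofI) (auto simp: ge_def)
  next
    fix C assume "C \<in> Chains (relation_of ge A)"
    then have sub: "C \<subseteq> A" and chain: "\<And>q r. q \<in> C \<Longrightarrow> r \<in> C \<Longrightarrow> q \<le> r \<or> r \<le> q"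
      by (auto simp: Chains_def relation_of_def ge_def)
    show "\<exists>u\<in>A. \<forall>q\<in>C. ge q u"
    proof (cases "C = {}")
      case True
      then show ?thesis using p by (auto simp: A_def)
    next
      case False
      define u where "u x = (INF q\<in>C. q x)" for x
      have sl: "sublinear q" "q x \<le> p x" if "q \<in> C" for q x
        using that sub by (auto simp: A_def le_fun_def)
      have "- p (- x) \<le> q x" if "q \<in> C" for q x
        using sublinear_lower[OF sl(1)[OF that], of x] sl(2)[OF that, of "- x"] by linarith
      then have "bdd_below ((\<lambda>q. q x) ` C)" for x
        by (intro bdd_belowI2[of _ "- p (- x)"])
      then have le: "u x \<le> q x" if "q \<in> C" for q x
        unfolding u_def using that by (intro cINF_lower)
      have ge: "a \<le> u x" if "\<And>q. q \<in> C \<Longrightarrow> a \<le> q x" for a x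
        unfolding u_def using that False by (intro cINF_greatest)
      have "u (x + y) \<le> u x + u y" for x y
      proof -
        have *: "u (x + y) \<le> q x + r y" if qr: "q \<in> C" "r \<in> C" for q r
        proof -
          obtain s where s: "s \<in> C" "s \<le> q" "s \<le> r"
            using chain[OF qr] qr by auto
          have "u (x + y) \<le> s (x + y)" by (rule le[OF s(1)])
          also have "\<dots> \<le> s x + s y" by (rule sublinear_add[OF sl(1)[OF s(1)]])
          also have "\<dots> \<le> q x + r y" using s by (intro add_mono) (auto simp: le_fun_def)
          finally show ?thesis .
        qed
        have "u (x + y) - r y \<le> u x" if "r \<in> C" for r
          using *[OF _ that] by (intro ge) (simp add: algebra_simps)
        then have "u (x + y) - u x \<le> u y"
          by (intro ge) (simp add: algebra_simps)
        then show ?thesis by simp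
      qed
      moreover have "u (c *\<^sub>R x) \<le> c * u x" if c: "c \<ge> 0" for c x
      proof (cases "c = 0")
        case True
        obtain q where q: "q \<in> C" using False by blast
        show ?thesis using True le[OF q, of 0] sublinear_zero[OF sl(1)[OF q]] by simp
      next
        case False
        then have c: "c > 0" using that by simp
        have "u (c *\<^sub>R x) / c \<le> q x" if "q \<in> C" for q
          using le[OF that, of "c *\<^sub>R x"] sublinear_scale[OF sl(1)[OF that], of c x] c
          by (simp add: field_simps)
        then have "u (c *\<^sub>R x) / c \<le> u x" by (rule ge)
        then show ?thesis using c by (simp add: field_simps)
      qed
      ultimately have "sublinear u" by (simp add: sublinear_def)
      moreover have "u \<le> p"
      proof (rule le_funI)
        fix x
        obtain q where "q \<in> C" using False by blast
        then show "u x \<le> p x" using le[of q x] sl(2)[of q x] by linarith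
      qed
      ultimately show ?thesis using le by (auto simp: A_def ge_def le_fun_def)
    qed
  qed
  then obtain m where m: "sublinear m" "m \<le> p"
    and min: "\<And>q. sublinear q \<Longrightarrow> q \<le> p \<Longrightarrow> q \<le> m \<Longrightarrow> q = m"
    by (auto simp: A_def ge_def)
  have "linear m"
  proof (rule linear_minimal_sublinear[OF m(1)])
    fix q assume "sublinear q" "\<And>x. q x \<le> m x"
    then show "q = m" using min m(2) by (meson le_funI order_trans)
  qed
  then show thesis using m(2) by (intro that) (auto simp: le_fun_def)
qed

lemma exists_bounded_linear_nonzero:
  fixes x :: "'a::real_normed_vector"
  assumes "x \<noteq> 0"
  obtains f :: "'a \<Rightarrow> real" where "bounded_linear f" "f x \<noteq> 0"
proof -
  \<comment> \<open>A linear functional below the norm could be zero; lowering the norm at \<open>- x\<close> first forces the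
    value at \<open>x\<close> to be at least \<open>norm x\<close>.\<close>
  have "sublinear (norm :: 'a \<Rightarrow> real)"
    by (simp add: sublinear_def norm_triangle_ineq)
  then obtain q where q: "sublinear q" "\<And>y :: 'a. q y \<le> norm y" "q (- x) \<le> - norm x"
    using sublinear_lowering by blast
  obtain f where f: "linear f" "\<And>y. f y \<le> q y"
    using linear_below_sublinear[OF q(1)] by blast
  have "norm (f y) \<le> norm y * 1" for y
    using f(2)[of y] q(2)[of y] f(2)[of "- y"] q(2)[of "- y"] linear_neg[OF f(1), of y]
    by (simp add: abs_le_iff)
  then have "bounded_linear f"
    using f(1) by (intro bounded_linear_intro[of f 1]) (auto simp: linear_add linear_scale)
  moreover have "f x > 0"
    using f(2)[of "- x"] q(3) assms linear_neg[OF f(1), of x] 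
    by (smt (verit) zero_less_norm_iff)
  ultimately show thesis using that by force
qed

section \<open>Triangular sequences\<close>

lemma not_finitely_spanned_Int_kernel:
  fixes f :: "'a::real_vector \<Rightarrow> real"
  assumes "subspace M" "linear f" and inf: "\<nexists>B. finite B \<and> M \<subseteq> span B"
  shows "\<nexists>B. finite B \<and> M \<inter> {x. f x = 0} \<subseteq> span B"
proof
  assume "\<exists>B. finite B \<and> M \<inter> {x. f x = 0} \<subseteq> span B"
  then obtain B where B: "finite B" "M \<inter> {x. f x = 0} \<subseteq> span B" by blast
  obtain u where u: "u \<in> M" "f u \<noteq> 0" using inf B by blast
  have "x \<in> span (insert u B)" if "x \<in> M" for x
  proof -
    have "x - (f x / f u) *\<^sub>R u \<in> M \<inter> {x. f x = 0}"
      using u that assms by (auto simp: linear_diff linear_scale subspace_diff subspace_scale)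
    then show ?thesis using B by (auto simp: span_insert)
  qed
  then show False using inf B(1) by (meson finite_insert subsetI)
qed

text \<open>
  A sequence \<open>e\<close> together with continuous functionals \<open>f\<close> such that the matrix with entries
  \<open>f n (e m)\<close> is triangular with nonzero diagonal. The geometric bound on the norms makes all series
  with bounded coefficients converge.
\<close>

locale triangular_sequence =
  fixes e :: "nat \<Rightarrow> 'a::banach" and f :: "nat \<Rightarrow> 'a \<Rightarrow> real"
  assumes bounded_linear_f: "bounded_linear (f n)"
    and diagonal: "f n (e n) \<noteq> 0"
    and above_diagonal: "n < m \<Longrightarrow> f n (e m) = 0"
    and norm_e_le: "norm (e n) \<le> (1/2) ^ n"

lemma exists_triangular_sequence:
  assumes "infinite_dimensional TYPE('a::banach)"
  shows "\<exists>(e :: nat \<Rightarrow> 'a) f. triangular_sequence e f"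
proof -
  \<comment> \<open>\<open>M\<close> is the common kernel of the functionals chosen so far, \<open>x\<close> the next vector before scaling
    and \<open>g\<close> its functional.\<close>
  define good where "good = (\<lambda>(M :: 'a set, x :: 'a, g :: 'a \<Rightarrow> real).
    subspace M \<and> (\<nexists>B. finite B \<and> M \<subseteq> span B) \<and> x \<in> M \<and> bounded_linear g \<and> g x \<noteq> 0)"
  have extend: "\<exists>x g. good (M, x, g)"
    if M: "subspace M" "\<nexists>B. finite B \<and> M \<subseteq> span B" for M
  proof -
    have "\<not> M \<subseteq> span {}" using M(2) by blast
    then obtain x where "x \<in> M" "x \<noteq> 0" by auto
    moreover obtain g :: "'a \<Rightarrow> real" where "bounded_linear g" "g x \<noteq> 0"
      by (rule exists_bounded_linear_nonzero[OF \<open>x \<noteq> 0\<close>])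
    ultimately have "good (M, x, g)" using M by (simp add: good_def)
    then show ?thesis by blast
  qed
  have "\<exists>s. \<forall>n :: nat. good (s n) \<and> fst (s (Suc n)) = fst (s n) \<inter> {x. snd (snd (s n)) x = 0}"
  proof (rule dependent_nat_choice)
    have "\<nexists>B. finite B \<and> (UNIV :: 'a set) \<subseteq> span B"
      using assms by (auto simp: infinite_dimensional_def)
    then show "\<exists>s. good s" using extend[OF subspace_UNIV] by blast
  next
    fix s and n :: nat
    assume "good s"
    then obtain M x g where s: "s = (M, x, g)" "good (M, x, g)" by (cases s) auto
    have "linear g" using s(2) by (simp add: good_def bounded_linear.linear)
    then have "subspace (M \<inter> {x. g x = 0})"
      using s(2) by (simp add: good_def subspace_inter linear_subspace_kernel)
    moreover have "\<nexists>B. finite B \<and> M \<inter> {x. g x = 0} \<subseteq> span B"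
      using s(2) \<open>linear g\<close> by (intro not_finitely_spanned_Int_kernel) (auto simp: good_def)
    ultimately obtain x' g' where "good (M \<inter> {x. g x = 0}, x', g')"
      using extend by blast
    then show "\<exists>s'. good s' \<and> fst s' = fst s \<inter> {x. snd (snd s) x = 0}"
      using s(1) by force
  qed
  then obtain s where s: "\<And>n :: nat. good (s n)"
    "\<And>n. fst (s (Suc n)) = fst (s n) \<inter> {x. snd (snd (s n)) x = 0}" by blast
  define M x g where "M n = fst (s n)" and "x n = fst (snd (s n))" and "g n = snd (snd (s n))" for n
  have good: "subspace (M n)" "x n \<in> M n" "bounded_linear (g n)" "g n (x n) \<noteq> 0" for n
    using s(1)[of n] by (auto simp: good_def M_def x_def g_def split: prod.splits)
  have M_Suc: "M (Suc n) = M n \<inter> {x. g n x = 0}" for n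
    using s(2) by (simp add: M_def g_def)
  have ker: "g n (x m) = 0" if "n < m" for n m
  proof -
    have "M m \<subseteq> M (Suc n)" 
      by (rule lift_Suc_antimono_le) (use M_Suc that in auto)
    then show ?thesis using good(2)[of m] M_Suc[of n] by auto
  qed
  define e where "e n = ((1/2) ^ n / norm (x n)) *\<^sub>R x n" for n
  have "x n \<noteq> 0" for n
    using good(4)[of n] good(3)[of n] by (auto simp: linear_simps)
  then have "triangular_sequence e g"
    by (intro triangular_sequence.intro) (auto simp: e_def good ker linear_simps(5)[OF good(3)])
  then show ?thesis by blast
qed

section \<open>Subconvex coefficient sequences and their shift\<close>

text \<open>
  The coefficients of convex combinations of \<open>0\<close> and the vectors of a sequence; the weight of \<open>0\<close>
  is left implicit.
\<close>

definition subconvex :: "(nat \<Rightarrow> real) set" where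
  "subconvex = {t. (\<forall>n. 0 \<le> t n) \<and> summable t \<and> suminf t \<le> 1}"

lemma subconvex_le_1:
  assumes "t \<in> subconvex" shows "t n \<le> 1"
  using assms sum_le_suminf[of t "{n}"] by (auto simp: subconvex_def)

text \<open>
  A description by conditions on finitely many coordinates each, from which closedness in the
  product topology is evident.
\<close>

lemma subconvex_eq: "subconvex = {t. (\<forall>n. 0 \<le> t n) \<and> (\<forall>N. (\<Sum>n<N. t n) \<le> 1)}"
proof (intro set_eqI iffI)
  fix t :: "nat \<Rightarrow> real" assume "t \<in> {t. (\<forall>n. 0 \<le> t n) \<and> (\<forall>N. (\<Sum>n<N. t n) \<le> 1)}"
  then have t: "\<And>n. 0 \<le> t n" "\<And>N. (\<Sum>n<N. t n) \<le> 1" by auto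
  have "summable t" using t by (intro summableI_nonneg_bounded)
  then show "t \<in> subconvex" using t by (auto simp: subconvex_def intro: suminf_le_const)
next
  fix t assume "t \<in> subconvex"
  then show "t \<in> {t. (\<forall>n. 0 \<le> t n) \<and> (\<forall>N. (\<Sum>n<N. t n) \<le> 1)}"
    using sum_le_suminf[of t "{..<N}" for N] by (fastforce simp: subconvex_def intro: order_trans)
qed

text \<open>Compactness refers to the product topology on sequences.\<close>

lemma compact_subconvex: "compact subconvex"
proof -
  have "compactin (product_topology (\<lambda>_. euclidean) UNIV) (\<Pi>\<^sub>E n\<in>(UNIV :: nat set). {0..1::real})"
    by (subst compactin_PiE) auto
  then have cube: "compact (\<Pi>\<^sub>E n\<in>(UNIV :: nat set). {0..1::real})"
    by (simp add: euclidean_product_topology)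
  have cont: "continuous_on UNIV (\<lambda>t :: nat \<Rightarrow> real. t n)" for n
    by (rule continuous_on_product_coordinates)
  have "closed subconvex"
    unfolding subconvex_eq
    by (intro closed_Collect_conj closed_Collect_all closed_Collect_le continuous_intros
        continuous_on_sum cont)
  moreover have "subconvex \<subseteq> (\<Pi>\<^sub>E n\<in>UNIV. {0..1})"
    using subconvex_le_1 by (auto simp: subconvex_def)
  ultimately show ?thesis
    using compact_Int_closed[OF cube, of subconvex] by (simp add: Int_absorb1)
qed

lemma subconvex_convex_comb:
  assumes "t \<in> subconvex" "u \<in> subconvex" "0 \<le> a" "a \<le> 1"
  shows "(\<lambda>n. a * t n + (1 - a) * u n) \<in> subconvex"
    and "suminf (\<lambda>n. a * t n + (1 - a) * u n) = a * suminf t + (1 - a) * suminf u"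
proof -
  have "(\<lambda>n. a * t n + (1 - a) * u n) sums (a * suminf t + (1 - a) * suminf u)"
    using assms by (intro sums_add sums_mult) (auto simp: subconvex_def)
  then show "suminf (\<lambda>n. a * t n + (1 - a) * u n) = a * suminf t + (1 - a) * suminf u"
    and "(\<lambda>n. a * t n + (1 - a) * u n) \<in> subconvex"
    using assms convex_bound_le[of "suminf t" 1 "suminf u" a "1 - a"]
    by (auto simp: subconvex_def sums_iff)
qed

text \<open>
  The action of the map on coefficients: every weight moves one index up, and the implicit weight of
  \<open>0\<close> moves to index \<open>0\<close>.
\<close>

definition shift :: "(nat \<Rightarrow> real) \<Rightarrow> nat \<Rightarrow> real" where
  "shift t n = (case n of 0 \<Rightarrow> 1 - suminf t | Suc k \<Rightarrow> t k)"

lemma shift_simps [simp]: "shift t 0 = 1 - suminf t" "shift t (Suc k) = t k"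
  by (simp_all add: shift_def)

lemma shift_sums_1:
  assumes "t \<in> subconvex" shows "shift t sums 1"
proof -
  have "t sums suminf t" using assms by (auto simp: subconvex_def)
  then show ?thesis using sums_Suc[of "shift t" "suminf t"] by simp
qed

lemma shift_in_subconvex:
  assumes "t \<in> subconvex" shows "shift t \<in> subconvex"
proof -
  have "0 \<le> shift t n" for n
    using assms by (cases n) (auto simp: subconvex_def)
  then show ?thesis using shift_sums_1[OF assms] by (auto simp: subconvex_def sums_iff)
qed

lemma shift_funpow_in_subconvex: "t \<in> subconvex \<Longrightarrow> (shift ^^ n) t \<in> subconvex"
  by (induction n) (auto intro: shift_in_subconvex)

lemma shift_no_fixpoint:
  assumes "t \<in> subconvex" shows "shift t \<noteq> t"
proof
  assume fp: "shift t = t"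
  define c where "c = 1 - suminf t"
  have "t n = c" for n
  proof (induction n)
    case 0
    have "shift t 0 = c" by (simp add: c_def)
    then show ?case by (simp only: fp)
  next
    case (Suc n)
    have "shift t (Suc n) = t n" by simp
    then show ?case by (simp only: fp Suc.IH)
  qed
  then have t: "t = (\<lambda>_. c)" by auto
  have "t \<longlonglongrightarrow> 0" using assms by (intro summable_LIMSEQ_zero) (simp add: subconvex_def)
  then have "c = 0" by (simp add: t LIMSEQ_const_iff)
  moreover have "suminf t = 0" by (simp add: t \<open>c = 0\<close>)
  ultimately show False by (simp add: c_def)
qed

text \<open>
  The bound \<open>Suc j < n\<close> is sharp: one shift fills index \<open>0\<close>, and only from then on is the total
  weight \<open>1\<close>, so that zeros enter.
\<close>

lemma shift_funpow_vanishes: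
  assumes "t \<in> subconvex" shows "Suc j < n \<Longrightarrow> (shift ^^ n) t j = 0"
proof (induction n arbitrary: j)
  case (Suc n)
  show ?case
  proof (cases j)
    case 0
    then obtain m where m: "n = Suc m" using Suc.prems by (cases n) auto
    have "(shift ^^ n) t sums 1"
      using shift_sums_1[OF shift_funpow_in_subconvex[OF assms, of m]] m by simp
    then show ?thesis using 0 by (simp add: sums_iff)
  next
    case (Suc k)
    then show ?thesis using Suc.IH[of k] Suc.prems by simp
  qed
qed simp

text \<open>The sequence with entry \<open>1\<close> at index \<open>m\<close> and \<open>0\<close> elsewhere.\<close>

definition unit_seq :: "nat \<Rightarrow> nat \<Rightarrow> real" where
  "unit_seq m n = (if n = m then 1 else 0)"

lemma unit_seq_sums: "unit_seq m sums 1"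
  using sums_single[of m "\<lambda>_. 1 :: real"] by (simp add: unit_seq_def[abs_def])

lemma unit_seq_in_subconvex: "unit_seq m \<in> subconvex"
  using unit_seq_sums[of m] by (auto simp: subconvex_def sums_iff) (simp add: unit_seq_def)

lemma shift_unit_seq: "shift (unit_seq m) = unit_seq (Suc m)"
proof
  show "shift (unit_seq m) n = unit_seq (Suc m) n" for n
    using unit_seq_sums[of m] by (cases n) (auto simp: unit_seq_def sums_iff)
qed

lemma shift_funpow_unit_seq: "(shift ^^ n) (unit_seq m) = unit_seq (m + n)"
  by (induction n) (simp_all add: shift_unit_seq)

lemma zero_in_subconvex: "(\<lambda>_. 0) \<in> subconvex"
  by (simp add: subconvex_def)

lemma shift_zero: "shift (\<lambda>_. 0) = unit_seq 0"
proof
  show "shift (\<lambda>_. 0) n = unit_seq 0 n" for n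
    by (cases n) (auto simp: unit_seq_def)
qed

section \<open>The compact convex set and the affine map\<close>

context triangular_sequence
begin

text \<open>The vector with given coefficients. The series converges for subconvex coefficients.\<close>

definition combination :: "(nat \<Rightarrow> real) \<Rightarrow> 'a" where
  "combination t = (\<Sum>n. t n *\<^sub>R e n)"

lemma norm_term_le:
  assumes "t \<in> subconvex" shows "norm (t n *\<^sub>R e n) \<le> (1/2) ^ n"
  using mult_mono[of "\<bar>t n\<bar>" 1 "norm (e n)" "(1/2) ^ n"] subconvex_le_1[OF assms, of n] norm_e_le[of n] assms
  by (auto simp: subconvex_def)

lemma summable_terms:
  assumes "t \<in> subconvex" shows "summable (\<lambda>n. t n *\<^sub>R e n)"
  by (rule summable_comparison_test'[of "\<lambda>n. (1/2) ^ n" 0]) (use norm_term_le[OF assms] in auto)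

lemma continuous_on_combination: "continuous_on subconvex combination"
proof -
  have "uniform_limit subconvex (\<lambda>N t. \<Sum>n<N. t n *\<^sub>R e n) (\<lambda>t. \<Sum>n. t n *\<^sub>R e n) sequentially"
    by (rule Weierstrass_m_test[of _ _ "\<lambda>n. (1/2) ^ n"]) (use norm_term_le in auto)
  moreover have "continuous_on subconvex (\<lambda>t. \<Sum>n<N. t n *\<^sub>R e n)" for N
    by (intro continuous_intros continuous_on_subset[OF continuous_on_product_coordinates]) auto
  ultimately have "continuous_on subconvex (\<lambda>t. \<Sum>n. t n *\<^sub>R e n)"
    by (intro uniform_limit_theorem[of _ "\<lambda>N t. \<Sum>n<N. t n *\<^sub>R e n" sequentially]) auto
  then show ?thesis by (simp add: combination_def[abs_def])
qed

lemma inj_on_combination: "inj_on combination subconvex"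
proof (rule inj_onI)
  fix t u assume tu: "t \<in> subconvex" "u \<in> subconvex" "combination t = combination u"
  have sums0: "(\<lambda>n. (t n - u n) *\<^sub>R e n) sums 0"
    using sums_diff[OF summable_sums[OF summable_terms[OF tu(1)]] summable_sums[OF summable_terms[OF tu(2)]]]
      tu(3) by (simp add: combination_def algebra_simps)
  have "t n - u n = 0" for n
  proof (induction n rule: less_induct)
    case (less n)
    interpret fn: bounded_linear "f n" by (rule bounded_linear_f)
    \<comment> \<open>Under \<open>f n\<close> the terms beyond \<open>n\<close> vanish by triangularity, those before \<open>n\<close> by induction.\<close>
    have "(\<lambda>k. f n ((t k - u k) *\<^sub>R e k)) sums 0"
      using fn.sums[OF sums0] by (simp add: fn.zero)
    moreover have "f n ((t k - u k) *\<^sub>R e k) = (if k = n then (t n - u n) * f n (e n) else 0)" for k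
      using less.IH[of k] above_diagonal[of n k] by (cases k n rule: linorder_cases) (auto simp: fn.scale)
    ultimately have "(\<lambda>k. if k = n then (t n - u n) * f n (e n) else 0) sums 0" by simp
    then have "(t n - u n) * f n (e n) = 0"
      using sums_single[of n "\<lambda>_. (t n - u n) * f n (e n)"] sums_unique2 by blast
    then show ?case using diagonal[of n] by simp
  qed
  then show "t = u" by auto
qed

lemma combination_convex_comb:
  assumes "t \<in> subconvex" "u \<in> subconvex"
  shows "combination (\<lambda>n. a * t n + (1 - a) * u n) = a *\<^sub>R combination t + (1 - a) *\<^sub>R combination u"
proof -
  have "(\<lambda>n. a *\<^sub>R (t n *\<^sub>R e n) + (1 - a) *\<^sub>R (u n *\<^sub>R e n)) sums
      (a *\<^sub>R combination t + (1 - a) *\<^sub>R combination u)"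
    unfolding combination_def by (intro sums_add sums_scaleR_right summable_sums summable_terms assms)
  then show ?thesis by (simp add: combination_def sums_iff algebra_simps)
qed

lemma norm_combination_le:
  assumes t: "t \<in> subconvex" and van: "\<And>j. j < n \<Longrightarrow> t j = 0"
  shows "norm (combination t) \<le> (1/2) ^ n"
proof -
  have term_le: "norm (t j *\<^sub>R e j) \<le> t j * (1/2) ^ n" for j
  proof (cases "j < n")
    case False
    have "norm (e j) \<le> (1/2) ^ n"
      by (rule order_trans[OF norm_e_le power_decreasing]) (use False in auto)
    then show ?thesis using t by (auto simp: subconvex_def intro!: mult_left_mono)
  qed (simp add: van)
  have t': "summable t" "suminf t \<le> 1" using t by (auto simp: subconvex_def)
  have "norm (combination t) \<le> (\<Sum>j. t j * (1/2) ^ n)"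
    unfolding combination_def using t' by (intro norm_suminf_le term_le summable_mult2) 
  also have "\<dots> = suminf t * (1/2) ^ n" using t' by (simp add: suminf_mult2)
  also have "\<dots> \<le> 1 * (1/2) ^ n" using t' by (intro mult_right_mono) auto
  finally show ?thesis by simp
qed

lemma combination_unit_seq: "combination (unit_seq m) = e m"
proof -
  have "(\<lambda>n. unit_seq m n *\<^sub>R e n) = (\<lambda>n. if n = m then e n else 0)"
    by (auto simp: unit_seq_def)
  then show ?thesis using sums_single[of m e] by (simp add: combination_def sums_iff)
qed

lemma combination_zero: "combination (\<lambda>_. 0) = 0"
  by (simp add: combination_def)

text \<open>The simplex with vertices \<open>0, e 0, e 1, \<dots>\<close>.\<close>

definition K :: "'a set" where
  "K = combination ` subconvex"

text \<open>
  The map acts on \<open>K\<close> by shifting coefficients; \<open>the_inv_into\<close> recovers these, and the values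
  outside of \<open>K\<close> are irrelevant.
\<close>

definition T :: "'a \<Rightarrow> 'a" where
  "T x = combination (shift (the_inv_into subconvex combination x))"

lemma T_combination: "t \<in> subconvex \<Longrightarrow> T (combination t) = combination (shift t)"
  by (simp add: T_def the_inv_into_f_f[OF inj_on_combination])

lemma T_funpow_combination: "t \<in> subconvex \<Longrightarrow> (T ^^ n) (combination t) = combination ((shift ^^ n) t)"
  by (induction n) (simp_all add: T_combination shift_funpow_in_subconvex)

lemma compact_K: "compact K"
  unfolding K_def by (rule compact_continuous_image[OF continuous_on_combination compact_subconvex])

lemma convex_K: "convex K"
proof (rule convexI)
  fix x y :: 'a and a b :: real
  assume ab: "0 \<le> a" "0 \<le> b" "a + b = 1" and "x \<in> K" "y \<in> K"
  then obtain t u where tu: "t \<in> subconvex" "u \<in> subconvex" "x = combination t" "y = combination u"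
    by (auto simp: K_def)
  have b: "b = 1 - a" "a \<le> 1" using ab by auto
  have "a *\<^sub>R x + b *\<^sub>R y = combination (\<lambda>n. a * t n + (1 - a) * u n)"
    unfolding tu(3,4) b(1) by (rule combination_convex_comb[OF tu(1,2), symmetric])
  then show "a *\<^sub>R x + b *\<^sub>R y \<in> K"
    unfolding K_def using subconvex_convex_comb(1)[OF tu(1,2) ab(1) b(2)] by (rule image_eqI)
qed

lemma affine_map_on_T: "affine_map_on K T"
  unfolding affine_map_on_def
proof (intro ballI allI impI)
  fix x y and a :: real
  assume "x \<in> K" "y \<in> K" and a: "0 \<le> a \<and> a \<le> 1"
  then obtain t u where tu: "t \<in> subconvex" "u \<in> subconvex" "x = combination t" "y = combination u"
    by (auto simp: K_def)
  let ?v = "\<lambda>n. a * t n + (1 - a) * u n"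
  have v: "?v \<in> subconvex" "suminf ?v = a * suminf t + (1 - a) * suminf u"
    using subconvex_convex_comb[OF tu(1,2)] a by auto
  have "shift ?v n = a * shift t n + (1 - a) * shift u n" for n
    using v(2) by (cases n) (auto simp: algebra_simps)
  then have "shift ?v = (\<lambda>n. a * shift t n + (1 - a) * shift u n)" by auto
  then have "T (combination ?v) = combination (\<lambda>n. a * shift t n + (1 - a) * shift u n)"
    using T_combination[OF v(1)] by simp
  then show "T (a *\<^sub>R x + (1 - a) *\<^sub>R y) = a *\<^sub>R T x + (1 - a) *\<^sub>R T y"
    using tu by (simp add: T_combination combination_convex_comb shift_in_subconvex)
qed

lemma norm_T_funpow_le:
  assumes "x \<in> K" shows "norm ((T ^^ Suc n) x) \<le> (1/2) ^ n"
proof -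
  obtain t where t: "t \<in> subconvex" "x = combination t" using assms by (auto simp: K_def)
  show ?thesis unfolding t(2) T_funpow_combination[OF t(1)]
    by (intro norm_combination_le shift_funpow_in_subconvex shift_funpow_vanishes t) simp
qed

lemma asymptotically_Hoelder_T: "asymptotically_Hoelder_nonexpansive_type K T"
  unfolding asymptotically_Hoelder_nonexpansive_type_def
proof (intro exI[of _ "\<lambda>_. 1"] conjI ballI)
  fix x assume x: "x \<in> K"
  let ?d = "\<lambda>n. SUP y\<in>K. ereal (norm ((T ^^ n) x - (T ^^ n) y) - norm (x - y) powr 1)"
  have "?d (Suc n) \<le> ereal (2 * (1/2) ^ n)" for n
  proof (rule SUP_least)
    fix y assume "y \<in> K"
    then have "norm ((T ^^ Suc n) x - (T ^^ Suc n) y) \<le> (1/2) ^ n + (1/2) ^ n"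
      using norm_triangle_ineq4 norm_T_funpow_le x by (meson add_mono order_trans)
    moreover have "0 \<le> norm (x - y) powr 1" by simp
    ultimately show "ereal (norm ((T ^^ Suc n) x - (T ^^ Suc n) y) - norm (x - y) powr 1)
        \<le> ereal (2 * (1/2) ^ n)"
      unfolding ereal_less_eq by linarith
  qed
  then have "limsup (\<lambda>n. ?d (Suc n)) \<le> limsup (\<lambda>n. ereal (2 * (1/2) ^ n))"
    by (intro Limsup_mono always_eventually allI)
  also have "limsup (\<lambda>n. ereal (2 * (1/2) ^ n)) = 0"
  proof (rule lim_imp_Limsup)
    have "(\<lambda>n. 2 * (1/2 :: real) ^ n) \<longlonglongrightarrow> 2 * 0"
      by (intro tendsto_mult_left LIMSEQ_power_zero) simp
    then show "(\<lambda>n. ereal (2 * (1/2) ^ n)) \<longlonglongrightarrow> 0" by (simp add: zero_ereal_def)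
  qed simp
  finally show "limsup ?d \<le> 0" using limsup_shift[of ?d] by (simp only: Suc_eq_plus1)
qed auto

lemma not_continuous_on_T_funpow:
  assumes "n \<ge> 1" shows "\<not> continuous_on K (T ^^ n)"
proof
  assume cont: "continuous_on K (T ^^ n)"
  have e_lim: "e \<longlonglongrightarrow> 0"
    by (rule tendsto_norm_zero_cancel, rule real_tendsto_sandwich[of "\<lambda>_. 0" _ _ "\<lambda>n. (1/2) ^ n"])
      (auto simp: norm_e_le LIMSEQ_power_zero)
  have e_K: "e m \<in> K" for m
    unfolding K_def using combination_unit_seq unit_seq_in_subconvex by (metis imageI)
  have zero_K: "0 \<in> K"
    unfolding K_def using combination_zero zero_in_subconvex by (metis imageI)
  obtain k where k: "n = Suc k" using assms by (cases n) auto
  have "(T ^^ n) 0 = combination ((shift ^^ n) (\<lambda>_. 0))"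
    using T_funpow_combination[OF zero_in_subconvex] by (simp add: combination_zero)
  also have "\<dots> = e k"
    unfolding k by (simp only: funpow_Suc_right o_apply shift_zero shift_funpow_unit_seq combination_unit_seq) simp
  finally have T0: "(T ^^ n) 0 = e k" .
  have Te: "(T ^^ n) (e m) = e (m + n)" for m
    using T_funpow_combination[OF unit_seq_in_subconvex, of n m]
    by (simp add: combination_unit_seq shift_funpow_unit_seq)
  have "(\<lambda>m. (T ^^ n) (e m)) \<longlonglongrightarrow> (T ^^ n) 0"
    using continuous_on_tendsto_compose[OF cont e_lim zero_K] e_K by auto
  then have "(\<lambda>m. e (m + n)) \<longlonglongrightarrow> e k" by (simp add: Te T0)
  moreover have "(\<lambda>m. e (m + n)) \<longlonglongrightarrow> 0" using e_lim by (rule LIMSEQ_ignore_initial_segment)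
  ultimately have "e k = 0" by (rule LIMSEQ_unique)
  then show False using diagonal[of k] bounded_linear_f[of k] by (simp add: linear_simps)
qed

end

section \<open>The fixed-point-free affine map\<close>

theorem theorem3p4:
  assumes "infinite_dimensional TYPE('a::banach)"
  shows "\<exists>(K :: 'a set) (T :: 'a \<Rightarrow> 'a).
           K \<noteq> {} \<and> compact K \<and> convex K \<and>
           T \<in> K \<rightarrow> K \<and> affine_map_on K T \<and>
           (\<forall>x\<in>K. T x \<noteq> x) \<and>
           asymptotically_Hoelder_nonexpansive_type K T \<and>
           (\<forall>n\<ge>1. \<not> continuous_on K (T ^^ n))"
proof -
  obtain e :: "nat \<Rightarrow> 'a" and f where "triangular_sequence e f"
    using exists_triangular_sequence[OF assms] by blast
  then interpret triangular_sequence e f .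
  have "T \<in> K \<rightarrow> K"
    by (auto simp: K_def T_combination shift_in_subconvex)
  moreover have "T x \<noteq> x" if "x \<in> K" for x
  proof -
    obtain t where t: "t \<in> subconvex" "x = combination t" using \<open>x \<in> K\<close> by (auto simp: K_def)
    then show ?thesis
      using inj_onD[OF inj_on_combination, of "shift t" t] shift_no_fixpoint shift_in_subconvex
      by (auto simp: T_combination)
  qed
  moreover have "K \<noteq> {}" using zero_in_subconvex by (auto simp: K_def)
  ultimately show ?thesis
    using compact_K convex_K affine_map_on_T asymptotically_Hoelder_T not_continuous_on_T_funpow
    by blast
qed

end
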